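(* For every integer $n\ge 2$, the set $U_n$ is a body of constant width $2$ in $\mathbb{E}^n$ with the symmetries of a regular $n$-simplex.
   Context: $\mathbb{E}^n$ denotes $n$-dimensional Euclidean space with Euclidean norm $|\cdot|$, and $\mathbb{E}^n_+$ is the subset of $\mathbb{E}^n$ consisting of the points all of whose coordinates are non-negative. A convex body in $\mathbb{E}^n$ is a convex compact set with non-empty interior. A convex body has constant width $w$ if its orthogonal projection onto any line has length $w$. A regular $n$-simplex is a convex polyhedron in $\mathbb{E}^n$ with $n+1$ equidistant vertices. A convex body $U\subset\mathbb{E}^n$ has the symmetries of a regular $n$-simplex if there exists a regular $n$-simplex $\Delta$ such that the full symmetry group of $\Delta$ acts as symmetries of $U$; equivalently, $\tau(U)=U$ for every orthogonal transformation $\tau$ satisfying $\tau(\Delta)=\Delta$ (where $\Delta$ is centered at the origin). For a positive integer $m$ define $$M_m:=\bigl\{v-w \mid v,w\in\mathbb{E}^m_+,\ |v|^2+\bigl(|w|+\sqrt{2}\bigr)^2\le 4\bigr\}\subset\mathbb{E}^m.$$ $U_n$ is the orthogonal projection of $M_{n+1}$ onto the $n$-dimensional subspace $(1,\ldots,1)^\perp$ of $\mathbb{E}^{n+1}$ orthogonal to $(1,\dots,1)\in\mathbb{E}^{n+1}$: $$U_n=\{\operatorname{proj}_{(1,\ldots,1)^\perp}(v)\mid v\in M_{n+1}\}.$$ This subspace is identified isometrically (by a linear isometry) with $\mathbb{E}^n$. *)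

theory Defs
  imports "HOL-Analysis.Analysis"
begin

section \<open>Convex bodies of constant width\<close>

definition convex_body :: "'a::euclidean_space set \<Rightarrow> bool" where
  "convex_body U \<longleftrightarrow> convex U \<and> compact U \<and> interior U \<noteq> {}"

text \<open>Orthogonal projection onto an affine subspace; the description determines the
  point uniquely when the set is affine and nonempty (lemma \<open>orth_proj_unique_exists\<close>).\<close>

definition orth_proj :: "'a::euclidean_space set \<Rightarrow> 'a \<Rightarrow> 'a" where
  "orth_proj L x = (THE y. y \<in> L \<and> (\<forall>z\<in>L. orthogonal (x - y) (z - y)))"

lemma orth_proj_unique_exists:
  fixes L :: "'a::euclidean_space set"
  assumes "affine L" "L \<noteq> {}"
  shows "\<exists>!y. y \<in> L \<and> (\<forall>z\<in>L. orthogonal (x - y) (z - y))"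
proof -
  obtain a where a: "a \<in> L" using assms by blast
  define S where "S = (\<lambda>z. - a + z) ` L"
  have S: "subspace S"
    unfolding S_def using affine_diffs_subspace[OF assms(1) a] .
  then have sp: "span S = S" by (simp add: span_eq_iff)
  obtain y z where y: "y \<in> span S" and z: "\<And>w. w \<in> span S \<Longrightarrow> orthogonal z w"
    and xa: "x - a = y + z"
    using orthogonal_subspace_decomp_exists[of S "x - a"] by metis
  have mem: "v - a \<in> S" if "v \<in> L" for v using that by (auto simp: S_def)
  have "y \<in> S" using y sp by simp
  then have ya: "y + a \<in> L" by (auto simp: S_def)
  have "orthogonal (x - (y + a)) (v - (y + a))" if "v \<in> L" for v
  proof -
    have "v - (y + a) = (v - a) - y" by simp
    then have "v - (y + a) \<in> S" using mem[OF that] y sp S by (metis subspace_diff)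
    moreover have "x - (y + a) = z" using xa by (simp add: algebra_simps)
    ultimately show ?thesis using z sp by metis
  qed
  moreover have "p = q"
    if "p \<in> L" "\<forall>z\<in>L. orthogonal (x - p) (z - p)" "q \<in> L" "\<forall>z\<in>L. orthogonal (x - q) (z - q)"
    for p q
  proof -
    have "(x - p) \<bullet> (q - p) = 0" "(x - q) \<bullet> (p - q) = 0"
      using that by (auto simp: orthogonal_def)
    then have "(q - p) \<bullet> (q - p) = 0"
      by (simp add: inner_diff inner_commute)
    then show ?thesis by simp
  qed
  ultimately show ?thesis using ya by blast
qed

definition constant_width :: "real \<Rightarrow> 'a::euclidean_space set \<Rightarrow> bool" where
  "constant_width w U \<longleftrightarrow>
     (\<forall>L. affine L \<and> aff_dim L = 1 \<longrightarrow>
        (\<exists>a b. orth_proj L ` U = closed_segment a b \<and> dist a b = w))"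

section \<open>Symmetries of a regular simplex\<close>

text \<open>Extreme points of a polytope are its vertices.\<close>

definition regular_simplex :: "'a::euclidean_space set \<Rightarrow> bool" where
  "regular_simplex D \<longleftrightarrow>
     polytope D \<and> card {v. v extreme_point_of D} = DIM('a) + 1 \<and>
     (\<exists>d. \<forall>u v. u extreme_point_of D \<and> v extreme_point_of D \<and> u \<noteq> v \<longrightarrow> dist u v = d)"

text \<open>The simplex has its centroid at the origin, so its symmetries are orthogonal
  transformations.\<close>

definition has_regular_simplex_symmetries :: "'a::euclidean_space set \<Rightarrow> bool" where
  "has_regular_simplex_symmetries U \<longleftrightarrow>
     (\<exists>D. regular_simplex D \<and> (\<Sum>v | v extreme_point_of D. v) = 0 \<and>
        (\<forall>\<tau>. orthogonal_transformation \<tau> \<and> \<tau> ` D = D \<longrightarrow> \<tau> ` U = U))"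

section \<open>The sets \<open>M\<^sub>m\<close> and \<open>U\<^sub>n\<close>\<close>

definition nonneg_orthant :: "(real ^ 'm) set" where
  "nonneg_orthant = {x. \<forall>i. 0 \<le> x $ i}"

definition M_set :: "(real ^ 'm) set" where
  "M_set = {v - w | v w. v \<in> nonneg_orthant \<and> w \<in> nonneg_orthant \<and>
                         (norm v)\<^sup>2 + (norm w + sqrt 2)\<^sup>2 \<le> 4}"

definition diag_hyperplane :: "(real ^ 'm) set" where
  "diag_hyperplane = orthogonal_comp {vec 1}"

text \<open>\<open>U_set\<close> is \<open>U\<^sub>n\<close> inside the ambient space of dimension \<open>n + 1 = CARD('m)\<close>.\<close>

definition U_set :: "(real ^ 'm) set" where
  "U_set = orth_proj diag_hyperplane ` M_set"

text \<open>A linear isometry of \<open>n\<close>-space onto the hyperplane. Transporting \<open>U\<^sub>n\<close> to \<open>n\<close>-space means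
  taking the preimage under such a map.\<close>

definition hyperplane_identification :: "(real ^ 'n \<Rightarrow> real ^ 'm) \<Rightarrow> bool" where
  "hyperplane_identification \<phi> \<longleftrightarrow>
     linear \<phi> \<and> (\<forall>x. norm (\<phi> x) = norm x) \<and> range \<phi> = diag_hyperplane"

lemma hyperplane_identification_exists:
  assumes "CARD('m) = CARD('n) + 1"
  shows "\<exists>\<phi> :: real ^ 'n \<Rightarrow> real ^ 'm. hyperplane_identification \<phi>"
proof -
  have "(diag_hyperplane :: (real ^ 'm) set) = {x. vec 1 \<bullet> x = 0}"
    by (auto simp: diag_hyperplane_def orthogonal_comp_def orthogonal_def)
  moreover have "(vec 1 :: real ^ 'm) \<noteq> 0"
    by (simp add: vec_eq_iff)
  ultimately have "dim (diag_hyperplane :: (real ^ 'm) set) = CARD('n)"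
    using dim_hyperplane[of "vec 1 :: real ^ 'm"] assms by simp
  then have "dim (UNIV :: (real ^ 'n) set) = dim (diag_hyperplane :: (real ^ 'm) set)"
    by simp
  moreover have "subspace (diag_hyperplane :: (real ^ 'm) set)"
    by (simp add: diag_hyperplane_def subspace_orthogonal_comp)
  ultimately obtain f :: "real ^ 'n \<Rightarrow> real ^ 'm"
    where "linear f" "f ` UNIV = diag_hyperplane" "\<And>x. x \<in> UNIV \<Longrightarrow> norm (f x) = norm x"
    using isometries_subspaces[OF subspace_UNIV] by metis
  then show ?thesis by (auto simp: hyperplane_identification_def)
qed

end

theory Submission
  imports Defs
begin

text \<open>Write \<open>p\<close> and \<open>q\<close> for the norms of the positive and the negative part of a unit vector
  \<open>e\<close>. Maximizing \<open>v \<bullet> e - w \<bullet> e\<close> over \<open>M\<close> reduces to maximizing \<open>a p + b q\<close> over the part of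
  a disc of radius 2 that lies in a quadrant, which gives \<open>sqrt 2 p\<close> if \<open>p \<ge> q\<close> and
  \<open>2 - sqrt 2 q\<close> otherwise. Passing from \<open>e\<close> to \<open>-e\<close> swaps \<open>p\<close> and \<open>q\<close>, so the two values add up
  to 2: already \<open>M\<close> has constant width 2, and so do its projections. As \<open>M\<close> is invariant under
  permutations of the coordinates, its projection along \<open>(1,\<dots>,1)\<close> is invariant under the
  symmetries of the projection of the standard simplex.\<close>

section \<open>Widths of compact convex sets\<close>

lemma orth_proj_eqI:
  fixes L :: "'a::euclidean_space set"
  assumes "affine L" "y \<in> L" "\<And>z. z \<in> L \<Longrightarrow> orthogonal (x - y) (z - y)"
  shows "orth_proj L x = y"
  unfolding orth_proj_def
  using orth_proj_unique_exists[OF assms(1), of x] assms by (intro the1_equality) auto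

text \<open>An affine basis of a line consists of two points. Normalizing their difference makes the
  parameter an arc length.\<close>

lemma affine_aff_dim_1_E:
  fixes L :: "'a::euclidean_space set"
  assumes "affine L" "aff_dim L = 1"
  obtains p u where "norm u = 1" "L = range (\<lambda>t. p + t *\<^sub>R u)"
proof -
  obtain a b where ab: "a \<noteq> b" "L = affine hull {a, b}"
  proof -
    obtain S where S: "\<not> affine_dependent S" "affine hull S = affine hull L" "int (card S) = aff_dim L + 1"
      by (metis aff_dim_basis_exists add_diff_cancel_right' diff_add_cancel)
    have "card S = 2" using S(3) assms(2) by simp
    then obtain a b where "S = {a, b}" "a \<noteq> b" by (auto simp: card_2_iff)
    then show thesis using that S(2) assms(1) by (metis affine_hull_eq)
  qed
  define u where "u = (b - a) /\<^sub>R norm (b - a)"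
  have nz: "norm (b - a) \<noteq> 0" using ab by simp
  have bu: "b - a = norm (b - a) *\<^sub>R u" using nz by (simp add: u_def)
  have "L = range (\<lambda>t. a + t *\<^sub>R u)"
  proof (intro equalityI subsetI)
    fix x assume "x \<in> L"
    then obtain s t where "x = s *\<^sub>R a + t *\<^sub>R b" "s + t = 1"
      unfolding ab(2) affine_hull_2 by auto
    then have "x = a + t *\<^sub>R (b - a)"
      by (auto simp: algebra_simps simp flip: scaleR_add_left)
    then have "x = a + (t * norm (b - a)) *\<^sub>R u" by (subst (asm) bu) simp
    then show "x \<in> range (\<lambda>t. a + t *\<^sub>R u)" by blast
  next
    fix x assume "x \<in> range (\<lambda>t. a + t *\<^sub>R u)"
    then obtain t where "x = a + t *\<^sub>R u" by blast
    then have "x = (1 - t / norm (b - a)) *\<^sub>R a + (t / norm (b - a)) *\<^sub>R b"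
      by (simp add: u_def algebra_simps divide_inverse)
    then show "x \<in> L"
      unfolding ab(2) affine_hull_2 by (smt (verit) mem_Collect_eq)
  qed
  moreover have "norm u = 1" using nz by (simp add: u_def)
  ultimately show thesis using that by blast
qed

text \<open>The projection onto a line with unit direction \<open>u\<close> depends only on
  \<open>x \<bullet> u\<close> and is isometric in that value. Convexity makes these values fill the
  whole interval between the attained extremes.\<close>

lemma constant_widthI:
  fixes U :: "'a::euclidean_space set"
  assumes conv: "convex U"
    and wid: "\<And>u. norm u = 1 \<Longrightarrow>
      \<exists>x\<in>U. \<exists>y\<in>U. (\<forall>z\<in>U. x \<bullet> u \<le> z \<bullet> u \<and> z \<bullet> u \<le> y \<bullet> u) \<and> y \<bullet> u - x \<bullet> u = w"
  shows "constant_width w U"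
  unfolding constant_width_def
proof (intro allI impI)
  fix L :: "'a set" assume L: "affine L \<and> aff_dim L = 1"
  then obtain p u where u: "norm u = 1" and Leq: "L = range (\<lambda>t. p + t *\<^sub>R u)"
    using affine_aff_dim_1_E by blast
  have uu: "u \<bullet> u = 1" using u by (simp add: norm_eq_1)
  \<comment> \<open>\<open>g t\<close> is the point of \<open>L\<close> whose inner product with
    \<open>u\<close> is \<open>t\<close>.\<close>
  define g where "g t = p + (t - p \<bullet> u) *\<^sub>R u" for t
  have proj: "orth_proj L x = g (x \<bullet> u)" for x
  proof (rule orth_proj_eqI)
    show "affine L" using L by simp
    show "g (x \<bullet> u) \<in> L" by (auto simp: Leq g_def)
    fix z assume "z \<in> L"
    then obtain t where "z = p + t *\<^sub>R u" by (auto simp: Leq)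
    then show "orthogonal (x - g (x \<bullet> u)) (z - g (x \<bullet> u))"
      by (simp add: g_def orthogonal_def inner_diff inner_add algebra_simps uu inner_commute)
  qed
  obtain x y where xy: "x \<in> U" "y \<in> U" "\<And>z. z \<in> U \<Longrightarrow> x \<bullet> u \<le> z \<bullet> u \<and> z \<bullet> u \<le> y \<bullet> u"
    "y \<bullet> u - x \<bullet> u = w"
    using wid[OF u] by blast
  have "orth_proj L ` U = g ` (\<lambda>z. z \<bullet> u) ` U"
    by (simp add: image_image proj)
  also have "(\<lambda>z. z \<bullet> u) ` U = closed_segment (x \<bullet> u) (y \<bullet> u)"
  proof
    show "(\<lambda>z. z \<bullet> u) ` U \<subseteq> closed_segment (x \<bullet> u) (y \<bullet> u)"
      using xy by (force simp: closed_segment_eq_real_ivl)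
    have "linear (\<lambda>z. z \<bullet> u)"
      by (simp add: bounded_linear.linear bounded_linear_inner_left)
    then have "convex ((\<lambda>z. z \<bullet> u) ` U)"
      using conv by (rule convex_linear_image)
    then show "closed_segment (x \<bullet> u) (y \<bullet> u) \<subseteq> (\<lambda>z. z \<bullet> u) ` U"
      using xy by (intro closed_segment_subset) auto
  qed
  also have "g ` closed_segment (x \<bullet> u) (y \<bullet> u) = closed_segment (g (x \<bullet> u)) (g (y \<bullet> u))"
  proof -
    have "linear (\<lambda>t. t *\<^sub>R u)" by (intro linearI) (auto simp: algebra_simps)
    moreover have "g = (+) (p - (p \<bullet> u) *\<^sub>R u) \<circ> (\<lambda>t. t *\<^sub>R u)"
      by (auto simp: g_def algebra_simps)
    ultimately show ?thesis
      using closed_segment_linear_image[of "\<lambda>t. t *\<^sub>R u" "x \<bullet> u" "y \<bullet> u"]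
      by (simp only: image_comp[symmetric] o_apply closed_segment_translation)
  qed
  finally have "orth_proj L ` U = closed_segment (g (x \<bullet> u)) (g (y \<bullet> u))" .
  moreover have "dist (g (x \<bullet> u)) (g (y \<bullet> u)) = w"
  proof -
    have "g (y \<bullet> u) - g (x \<bullet> u) = w *\<^sub>R u"
      using xy(4) by (simp add: g_def algebra_simps flip: scaleR_diff_left)
    moreover have "w \<ge> 0" using xy by force
    ultimately show ?thesis by (metis abs_of_nonneg dist_commute dist_norm mult.right_neutral norm_scaleR u)
  qed
  ultimately show "\<exists>a b. orth_proj L ` U = closed_segment a b \<and> dist a b = w" by blast
qed

section \<open>The set \<open>M\<close>\<close>

text \<open>The negative part is written \<open>pos_part (- x)\<close>, so that replacing
  \<open>x\<close> by \<open>- x\<close> swaps the two parts.\<close>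

definition pos_part :: "real ^ 'm \<Rightarrow> real ^ 'm" where
  "pos_part x = (\<chi> i. max 0 (x $ i))"

lemma pos_part_nonneg: "pos_part x \<in> nonneg_orthant"
  by (simp add: pos_part_def nonneg_orthant_def)

lemma pos_part_diff: "pos_part x - pos_part (- x) = x"
  by (auto simp: pos_part_def vec_eq_iff max_def)

lemma inner_pos_part_self: "pos_part x \<bullet> x = (norm (pos_part x))\<^sup>2"
  by (simp add: power2_norm_eq_inner)
    (auto simp: pos_part_def inner_vec_def max_def intro!: sum.cong)

lemma inner_pos_part_neg: "pos_part x \<bullet> pos_part (- x) = 0"
  by (auto simp: pos_part_def inner_vec_def max_def intro!: sum.neutral)

lemma norm_pos_part_sq: "(norm (pos_part x))\<^sup>2 + (norm (pos_part (- x)))\<^sup>2 = (norm x)\<^sup>2"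
proof -
  have "(norm x)\<^sup>2 = (norm (pos_part x - pos_part (- x)))\<^sup>2" by (simp add: pos_part_diff)
  also have "\<dots> = (norm (pos_part x))\<^sup>2 + (norm (pos_part (- x)))\<^sup>2"
    unfolding power2_norm_eq_inner
    using inner_pos_part_neg[of x] by (simp add: inner_diff inner_commute)
  finally show ?thesis by simp
qed

text \<open>Against a non-negative vector, raising the negative coordinates of \<open>x\<close> to 0
  can only increase the inner product; Cauchy-Schwarz does the rest.\<close>

lemma inner_le_pos_part:
  assumes "v \<in> nonneg_orthant"
  shows "v \<bullet> x \<le> norm v * norm (pos_part x)"
proof -
  have "v \<bullet> x \<le> v \<bullet> pos_part x"
    using assms
    by (auto simp: pos_part_def inner_vec_def nonneg_orthant_def intro!: sum_mono mult_left_mono)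
  also have "\<dots> \<le> norm v * norm (pos_part x)" by (rule norm_cauchy_schwarz)
  finally show ?thesis .
qed

section \<open>Convexity, compactness and interior of M\<close>

definition M_pairs :: "((real ^ 'm) \<times> (real ^ 'm)) set" where
  "M_pairs = {z. fst z \<in> nonneg_orthant \<and> snd z \<in> nonneg_orthant \<and>
                 (norm (fst z))\<^sup>2 + (norm (snd z) + sqrt 2)\<^sup>2 \<le> 4}"

text \<open>Convexity and compactness are easier to check on the pairs, where the constraints are
  explicit, and they pass to \<open>M_set\<close> along this continuous linear map.\<close>

lemma M_set_eq: "M_set = (\<lambda>z. fst z - snd z) ` M_pairs"
  unfolding M_set_def M_pairs_def image_def
  by (rule Collect_cong) force

lemma M_setI:
  assumes "v \<in> nonneg_orthant" "w \<in> nonneg_orthant" "(norm v)\<^sup>2 + (norm w + sqrt 2)\<^sup>2 \<le> 4"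
  shows "v - w \<in> M_set"
  using assms by (auto simp: M_set_def)

lemma convex_nonneg_orthant: "convex nonneg_orthant"
  by (auto simp: convex_def nonneg_orthant_def)

lemma closed_nonneg_orthant: "closed nonneg_orthant"
  unfolding nonneg_orthant_def by (intro closed_Collect_all closed_Collect_le continuous_intros)

text \<open>The norm is convex, and squaring is convex and monotone on the non-negative reals, so
  both terms of the constraint are convex.\<close>

lemma convex_M_pairs: "convex M_pairs"
  unfolding convex_def
proof (intro ballI allI impI)
  fix x y :: "(real ^ 'm) \<times> (real ^ 'm)" and s t :: real
  assume x: "x \<in> M_pairs" and y: "y \<in> M_pairs" and s: "0 \<le> s" and t: "0 \<le> t" and st: "s + t = 1"
  let ?z = "s *\<^sub>R x + t *\<^sub>R y"
  have sq: "(s * a + t * b)\<^sup>2 \<le> s * a\<^sup>2 + t * b\<^sup>2" for a b :: real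
    using convex_onD[OF convex_power2, of t a b] s t st by (simp add: eq_diff_eq[symmetric])
  have "norm (fst ?z) \<le> s * norm (fst x) + t * norm (fst y)"
    using s t norm_triangle_ineq[of "s *\<^sub>R fst x" "t *\<^sub>R fst y"] by simp
  then have 1: "(norm (fst ?z))\<^sup>2 \<le> s * (norm (fst x))\<^sup>2 + t * (norm (fst y))\<^sup>2"
    using sq[of "norm (fst x)" "norm (fst y)"] by (meson norm_ge_zero order_trans power_mono)
  have "norm (snd ?z) \<le> s * norm (snd x) + t * norm (snd y)"
    using s t norm_triangle_ineq[of "s *\<^sub>R snd x" "t *\<^sub>R snd y"] by simp
  moreover have "sqrt 2 = s * sqrt 2 + t * sqrt 2"
    using st by (metis distrib_right mult_1)
  ultimately have "norm (snd ?z) + sqrt 2 \<le> s * (norm (snd x) + sqrt 2) + t * (norm (snd y) + sqrt 2)"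
    by (simp add: algebra_simps)
  then have 2: "(norm (snd ?z) + sqrt 2)\<^sup>2 \<le> s * (norm (snd x) + sqrt 2)\<^sup>2 + t * (norm (snd y) + sqrt 2)\<^sup>2"
    using sq[of "norm (snd x) + sqrt 2" "norm (snd y) + sqrt 2"]
    by (elim order_trans[OF power_mono]) auto
  have "s * ((norm (fst x))\<^sup>2 + (norm (snd x) + sqrt 2)\<^sup>2) + t * ((norm (fst y))\<^sup>2 + (norm (snd y) + sqrt 2)\<^sup>2)
      \<le> s * 4 + t * 4"
    using x y s t by (intro add_mono mult_left_mono) (auto simp: M_pairs_def)
  also have "\<dots> = 4" using st by (simp flip: distrib_right)
  finally have "(norm (fst ?z))\<^sup>2 + (norm (snd ?z) + sqrt 2)\<^sup>2 \<le> 4"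
    using 1 2 by (simp add: algebra_simps)
  then show "?z \<in> M_pairs"
    using x y s t st convexD[OF convex_nonneg_orthant] by (auto simp: M_pairs_def)
qed

lemma compact_M_pairs: "compact M_pairs"
proof -
  have "closed M_pairs"
    unfolding M_pairs_def
    by (intro closed_Collect_conj closed_Collect_le continuous_intros
        closed_vimage[OF closed_nonneg_orthant, unfolded vimage_def])
  moreover have "bounded M_pairs"
  proof -
    have "norm (fst z) \<le> 2 \<and> norm (snd z) \<le> 2" if "z \<in> M_pairs" for z
    proof -
      have "(norm (fst z))\<^sup>2 + (norm (snd z) + sqrt 2)\<^sup>2 \<le> 2\<^sup>2" using that by (simp add: M_pairs_def)
      then have "(norm (fst z))\<^sup>2 \<le> 2\<^sup>2" "(norm (snd z) + sqrt 2)\<^sup>2 \<le> 2\<^sup>2"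
        by (smt (verit) zero_le_power2)+
      then have "norm (fst z) \<le> 2" "norm (snd z) + sqrt 2 \<le> 2"
        by (auto intro: power2_le_imp_le)
      then show ?thesis by (smt (verit) real_sqrt_ge_zero)
    qed
    then have "M_pairs \<subseteq> cball 0 2 \<times> cball 0 2" by force
    then show ?thesis by (rule bounded_subset[rotated]) (intro bounded_Times bounded_cball)
  qed
  ultimately show ?thesis by (simp add: compact_eq_bounded_closed)
qed

lemma linear_fst_minus_snd: "linear (\<lambda>z. fst z - snd z)"
  by (intro linearI) (auto simp: algebra_simps)

lemma convex_M_set: "convex M_set"
  unfolding M_set_eq by (intro convex_linear_image linear_fst_minus_snd convex_M_pairs)

lemma compact_M_set: "compact M_set"
  unfolding M_set_eq by (intro compact_continuous_image continuous_intros compact_M_pairs)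

text \<open>The decomposition into positive and negative part is admissible near the origin: with
  3/2 as upper bound for \<open>sqrt 2\<close>, the constraint is at most 1/16 + 49/16 < 4. This
  later yields interior points.\<close>

lemma small_in_M_set:
  assumes "norm x \<le> 1/4"
  shows "x \<in> M_set"
proof -
  have "norm (pos_part x) \<le> 1/4" "norm (pos_part (- x)) \<le> 1/4"
    using norm_pos_part_sq[of x] assms
    by (smt (verit) norm_ge_zero power2_le_imp_le zero_le_power2)+
  then have "(norm (pos_part x))\<^sup>2 \<le> (1/4)\<^sup>2" "(norm (pos_part (- x)) + sqrt 2)\<^sup>2 \<le> (1/4 + 3/2)\<^sup>2"
    by (intro power_mono add_mono real_le_lsqrt; simp add: power2_eq_square)+
  then have "(norm (pos_part x))\<^sup>2 + (norm (pos_part (- x)) + sqrt 2)\<^sup>2 \<le> 4"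
    by (simp add: power2_eq_square)
  then show ?thesis
    using M_setI[OF pos_part_nonneg pos_part_nonneg, of x "- x"] by (simp add: pos_part_diff)
qed

section \<open>The support function of M on unit vectors\<close>

definition M_support :: "real ^ 'm \<Rightarrow> real" where
  "M_support e = (if norm (pos_part (- e)) \<le> norm (pos_part e)
     then sqrt 2 * norm (pos_part e) else 2 - sqrt 2 * norm (pos_part (- e)))"

text \<open>On the disc the maximizer is \<open>a = 2 * p\<close>,
  \<open>b = 2 * q - sqrt 2\<close>. Since \<open>p\<close> and \<open>q\<close> have square sum 1,
  this \<open>b\<close> is non-negative exactly if \<open>p \<le> q\<close>; otherwise the maximum
  moves to the corner \<open>a = sqrt 2\<close>, \<open>b = 0\<close>.\<close>

lemma M_support_ge:
  assumes e: "norm e = 1" and y: "y \<in> M_set"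
  shows "y \<bullet> e \<le> M_support e"
proof -
  define p q where "p = norm (pos_part e)" and "q = norm (pos_part (- e))"
  have pq: "p\<^sup>2 + q\<^sup>2 = 1" and p0: "0 \<le> p"
    using norm_pos_part_sq[of e] e by (auto simp: p_def q_def)
  obtain v w where vw: "y = v - w" "v \<in> nonneg_orthant" "w \<in> nonneg_orthant"
    "(norm v)\<^sup>2 + (norm w + sqrt 2)\<^sup>2 \<le> 4"
    using y by (auto simp: M_set_def)
  define a b where "a = norm v" and "b = norm w"
  have ab: "a\<^sup>2 + (b + sqrt 2)\<^sup>2 \<le> 4" and b0: "0 \<le> b" using vw by (auto simp: a_def b_def)
  have "y \<bullet> e = v \<bullet> e + w \<bullet> (- e)" by (simp add: vw inner_diff)
  also have "\<dots> \<le> a * p + b * q"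
    unfolding a_def b_def p_def q_def by (intro add_mono inner_le_pos_part vw)
  also have "\<dots> \<le> M_support e"
  proof (cases "q \<le> p")
    case True
    \<comment> \<open>This gives the tangent to the circle at the corner,
      \<open>a + b \<le> sqrt 2\<close>; as \<open>b\<close> is non-negative, \<open>q\<close> may
      then be replaced by the larger \<open>p\<close>.\<close>
    have "(a + (b + sqrt 2))\<^sup>2 \<le> 2 * (a\<^sup>2 + (b + sqrt 2)\<^sup>2)"
      using sum_squares_bound[of a "b + sqrt 2"] by (simp add: power2_sum)
    also have "\<dots> \<le> (2 * sqrt 2)\<^sup>2" using ab by (simp add: power_mult_distrib)
    finally have "a + (b + sqrt 2) \<le> 2 * sqrt 2" by (rule power2_le_imp_le) simp
    then have "(a + b) * p \<le> sqrt 2 * p" using p0 by (intro mult_right_mono) auto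
    moreover have "b * q \<le> b * p" using True b0 by (rule mult_left_mono)
    ultimately have "a * p + b * q \<le> sqrt 2 * p" by (simp add: algebra_simps)
    then show ?thesis using True by (simp add: M_support_def p_def q_def)
  next
    case False
    \<comment> \<open>Cauchy-Schwarz in the plane, with coordinates taken from the centre of the
      disc.\<close>
    have "(a * p + (b + sqrt 2) * q)\<^sup>2 \<le> (a\<^sup>2 + (b + sqrt 2)\<^sup>2) * (p\<^sup>2 + q\<^sup>2)"
      using zero_le_power2[of "a * q - (b + sqrt 2) * p"] by (simp add: power2_eq_square algebra_simps)
    also have "\<dots> \<le> 2\<^sup>2" using ab pq by simp
    finally have "a * p + (b + sqrt 2) * q \<le> 2" by (rule power2_le_imp_le) simp
    then show ?thesis using False by (simp add: M_support_def p_def q_def algebra_simps)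
  qed
  finally show ?thesis .
qed

lemma M_support_attained:
  assumes e: "norm e = 1"
  shows "\<exists>y\<in>M_set. y \<bullet> e = M_support e"
proof -
  define p q where "p = norm (pos_part e)" and "q = norm (pos_part (- e))"
  have pq: "p\<^sup>2 + q\<^sup>2 = 1" and p0: "0 \<le> p" "0 \<le> q"
    using norm_pos_part_sq[of e] e by (auto simp: p_def q_def)
  have ip: "pos_part e \<bullet> e = p\<^sup>2" and iq: "pos_part (- e) \<bullet> e = - q\<^sup>2"
    using inner_pos_part_self[of e] inner_pos_part_self[of "- e"] by (auto simp: p_def q_def)
  have scaled: "c *\<^sub>R pos_part x \<in> nonneg_orthant" if "0 \<le> c" for c and x :: "real ^ 'a"
    using that pos_part_nonneg[of x] by (auto simp: nonneg_orthant_def)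
  show ?thesis
  proof (cases "q \<le> p")
    case True
    then have "p > 0" using pq p0 by (cases "p = 0") auto
    \<comment> \<open>The corner of the region: \<open>v\<close> has norm \<open>sqrt 2\<close> and
      \<open>w\<close> is 0, so the constraint holds with equality.\<close>
    have "(sqrt 2 / p) *\<^sub>R pos_part e - 0 \<in> M_set"
      using \<open>p > 0\<close> by (intro M_setI scaled) (auto simp: nonneg_orthant_def simp flip: p_def)
    moreover have "((sqrt 2 / p) *\<^sub>R pos_part e - 0) \<bullet> e = M_support e"
      using True \<open>p > 0\<close> ip by (simp add: M_support_def power2_eq_square flip: p_def q_def)
    ultimately show ?thesis by blast
  next
    case False
    then have "q > 0" using p0 by simp
    \<comment> \<open>The maximizer on the circle is twice the unit vector with coordinates
      \<open>p\<close> and \<open>q\<close>; \<open>b\<close> is its second coordinate after undoing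
      the shift by \<open>sqrt 2\<close>.\<close>
    define b where "b = 2 * q - sqrt 2"
    have "p\<^sup>2 \<le> q\<^sup>2" using False p0 by (intro power_mono) auto
    then have "(sqrt 2)\<^sup>2 \<le> (2 * q)\<^sup>2" using pq by (simp add: power_mult_distrib)
    then have b0: "b \<ge> 0" unfolding b_def using p0 by (smt (verit) power2_le_imp_le)
    have "2 *\<^sub>R pos_part e - (b / q) *\<^sub>R pos_part (- e) \<in> M_set"
    proof (intro M_setI scaled)
      have "(norm (2 *\<^sub>R pos_part e))\<^sup>2 + (norm ((b / q) *\<^sub>R pos_part (- e)) + sqrt 2)\<^sup>2 =
          (2 * p)\<^sup>2 + (b + sqrt 2)\<^sup>2"
        using \<open>q > 0\<close> b0 by (simp flip: p_def q_def)
      also have "\<dots> = 4 * (p\<^sup>2 + q\<^sup>2)" by (simp add: b_def power_mult_distrib)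
      finally show "(norm (2 *\<^sub>R pos_part e))\<^sup>2 + (norm ((b / q) *\<^sub>R pos_part (- e)) + sqrt 2)\<^sup>2 \<le> 4"
        using pq by simp
    qed (use b0 p0 in auto)
    moreover have "(2 *\<^sub>R pos_part e - (b / q) *\<^sub>R pos_part (- e)) \<bullet> e = M_support e"
    proof -
      have "(2 *\<^sub>R pos_part e - (b / q) *\<^sub>R pos_part (- e)) \<bullet> e = 2 * p\<^sup>2 + b * q"
        using \<open>q > 0\<close> by (simp add: inner_diff ip iq power2_eq_square)
      also have "\<dots> = 2 * (p\<^sup>2 + q\<^sup>2) - sqrt 2 * q" by (simp add: b_def power2_eq_square algebra_simps)
      finally show ?thesis using pq False by (simp add: M_support_def flip: p_def q_def)
    qed
    ultimately show ?thesis by blast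
  qed
qed

text \<open>If the two norms differ, \<open>e\<close> and \<open>- e\<close> fall into different
  cases of \<open>M_support\<close> and the \<open>sqrt 2\<close> terms cancel. If they agree, both
  fall into the first case and each value is 1.\<close>

lemma M_support_antipodal:
  assumes e: "norm e = 1"
  shows "M_support e + M_support (- e) = 2"
proof (cases "norm (pos_part e) = norm (pos_part (- e))")
  case True
  then have "(sqrt 2 * norm (pos_part e))\<^sup>2 = 1\<^sup>2"
    using norm_pos_part_sq[of e] e by (simp add: power_mult_distrib)
  then have "sqrt 2 * norm (pos_part e) = 1"
    by (smt (verit) mult_nonneg_nonneg norm_ge_zero power2_eq_imp_eq real_sqrt_ge_zero)
  then show ?thesis using True by (simp add: M_support_def)
qed (auto simp: M_support_def)

text \<open>Permuting the coordinates of \<open>v\<close> and \<open>w\<close> separately preserves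
  the orthant and both norms.\<close>

lemma M_set_permute:
  fixes \<sigma> :: "'m::finite \<Rightarrow> 'm"
  assumes \<sigma>: "bij \<sigma>" and x: "x \<in> M_set"
  shows "(\<chi> i. x $ \<sigma> i) \<in> M_set"
proof -
  obtain v w where vw: "x = v - w" "v \<in> nonneg_orthant" "w \<in> nonneg_orthant"
    "(norm v)\<^sup>2 + (norm w + sqrt 2)\<^sup>2 \<le> 4"
    using x by (auto simp: M_set_def)
  have nrm: "norm (\<chi> i. y $ \<sigma> i) = norm y" for y :: "real ^ 'm"
    using sum.reindex_bij_betw[OF \<sigma>, of "\<lambda>i. (y $ i)\<^sup>2"] by (simp add: norm_vec_def L2_set_def)
  have "(\<chi> i. v $ \<sigma> i) - (\<chi> i. w $ \<sigma> i) \<in> M_set"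
    using vw by (intro M_setI) (auto simp: nrm nonneg_orthant_def)
  moreover have "(\<chi> i. v $ \<sigma> i) - (\<chi> i. w $ \<sigma> i) = (\<chi> i. x $ \<sigma> i)"
    by (simp add: vw vec_eq_iff)
  ultimately show ?thesis by simp
qed

section \<open>The projection along the diagonal\<close>

lemma mem_diag_hyperplane: "x \<in> diag_hyperplane \<longleftrightarrow> (\<Sum>i\<in>UNIV. x $ i) = 0"
  by (simp add: diag_hyperplane_def orthogonal_comp_def orthogonal_def inner_vec_def)

lemma extreme_point_of_injective_linear_image:
  assumes "linear f" "inj f" "x extreme_point_of S"
  shows "f x extreme_point_of (f ` S)"
  using assms
  by (auto simp: extreme_point_of_def open_segment_linear_image inj_image_mem_iff)

context
  fixes \<phi> :: "real ^ 'n \<Rightarrow> real ^ 'm"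
  assumes hyp: "hyperplane_identification \<phi>"
begin

lemma linear_ident: "linear \<phi>" and norm_ident: "norm (\<phi> x) = norm x"
  and range_ident: "range \<phi> = diag_hyperplane"
  using hyp by (auto simp: hyperplane_identification_def)

text \<open>By polarization, a linear map that preserves norms preserves inner products, so its
  adjoint is a left inverse.\<close>

lemma adjoint_ident: "adjoint \<phi> (\<phi> x) = x"
proof -
  have "\<phi> x \<bullet> \<phi> y = x \<bullet> y" for y
    using norm_ident[of "x + y"] norm_ident[of x] norm_ident[of y]
    by (simp add: dot_norm linear_add[OF linear_ident])
  then have "adjoint \<phi> (\<phi> x) \<bullet> y = x \<bullet> y" for y
    by (simp add: adjoint_clauses[OF linear_ident])
  then show ?thesis by (metis vector_eq_rdot)
qed

lemma linear_adj: "linear (adjoint \<phi>)"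
  by (rule adjoint_linear[OF linear_ident])

lemma ident_adjoint: "x \<in> diag_hyperplane \<Longrightarrow> \<phi> (adjoint \<phi> x) = x"
  unfolding range_ident[symmetric] using adjoint_ident by auto

text \<open>The all-ones vector is orthogonal to the range of \<open>\<phi>\<close>. This will
  centre the simplex at the origin.\<close>

lemma adjoint_1: "adjoint \<phi> 1 = 0"
proof -
  have "adjoint \<phi> 1 \<bullet> y = 0" for y
  proof -
    have "\<phi> y \<in> diag_hyperplane" using range_ident by auto
    then have "1 \<bullet> \<phi> y = 0" by (simp add: inner_vec_def mem_diag_hyperplane)
    then show ?thesis by (simp add: adjoint_clauses[OF linear_ident])
  qed
  then show ?thesis by (metis inner_eq_zero_iff)
qed

text \<open>As \<open>adjoint \<phi>\<close> inverts \<open>\<phi>\<close> on the left, it kills the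
  residual \<open>x - \<phi> (adjoint \<phi> x)\<close>, which is therefore orthogonal to the range
  of \<open>\<phi>\<close>.\<close>

lemma orth_proj_diag_hyperplane: "orth_proj diag_hyperplane x = \<phi> (adjoint \<phi> x)"
proof (rule orth_proj_eqI)
  show "affine (diag_hyperplane :: (real ^ 'm) set)"
    by (simp add: diag_hyperplane_def subspace_imp_affine subspace_orthogonal_comp)
  show "\<phi> (adjoint \<phi> x) \<in> diag_hyperplane" using range_ident by auto
  fix z :: "real ^ 'm" assume "z \<in> diag_hyperplane"
  then obtain t where "z = \<phi> t" using range_ident by auto
  then have "z - \<phi> (adjoint \<phi> x) = \<phi> (t - adjoint \<phi> x)" by (simp add: linear_diff[OF linear_ident])
  then show "orthogonal (x - \<phi> (adjoint \<phi> x)) (z - \<phi> (adjoint \<phi> x))"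
    by (simp add: orthogonal_def adjoint_clauses(2)[OF linear_ident, symmetric]
        adjoint_clauses(1)[OF linear_ident, symmetric] inner_diff_left adjoint_ident
        linear_diff[OF linear_adj])
qed

text \<open>Presents the body as a linear image of \<open>M_set\<close>; every property below is
  transferred through this description.\<close>

lemma vimage_U_set: "\<phi> -` U_set = adjoint \<phi> ` M_set"
  unfolding U_set_def orth_proj_diag_hyperplane
  by (auto simp: image_iff) (metis adjoint_ident)+

lemma convex_body_U: "convex_body (\<phi> -` U_set)"
proof -
  have "cball 0 (1/4) \<subseteq> \<phi> -` U_set"
  proof
    fix x :: "real ^ 'n" assume "x \<in> cball 0 (1/4)"
    \<comment> \<open>A small \<open>x\<close> is the image under \<open>adjoint \<phi>\<close> of
      \<open>\<phi> x\<close>, which has the same norm and so lies in \<open>M_set\<close>.\<close>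
    then have "\<phi> x \<in> M_set" by (intro small_in_M_set) (simp add: norm_ident)
    then show "x \<in> \<phi> -` U_set" unfolding vimage_U_set using adjoint_ident by (metis image_eqI)
  qed
  then have "ball 0 (1/4) \<subseteq> interior (\<phi> -` U_set)"
    by (meson ball_subset_cball interior_maximal open_ball order_trans)
  then have "interior (\<phi> -` U_set) \<noteq> {}" by force
  moreover have "convex (\<phi> -` U_set)"
    unfolding vimage_U_set by (rule convex_linear_image[OF linear_adj convex_M_set])
  moreover have "compact (\<phi> -` U_set)"
    unfolding vimage_U_set
    by (intro compact_continuous_image linear_continuous_on compact_M_set
        linear_conv_bounded_linear[THEN iffD1] linear_adj)
  ultimately show ?thesis by (simp add: convex_body_def)
qed

text \<open>By adjointness, the width of the projected set in direction \<open>u\<close> is the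
  width of \<open>M_set\<close> in direction \<open>\<phi> u\<close>.\<close>

lemma constant_width_U: "constant_width 2 (\<phi> -` U_set)"
proof (rule constant_widthI)
  show "convex (\<phi> -` U_set)" using convex_body_U by (simp add: convex_body_def)
  fix u :: "real ^ 'n" assume "norm u = 1"
  then have e: "norm (\<phi> u) = 1" "norm (- \<phi> u) = 1" by (simp_all add: norm_ident)
  \<comment> \<open>The minimizer in direction \<open>\<phi> u\<close> is found as the maximizer in
    the opposite direction.\<close>
  obtain x y where xy: "x \<in> M_set" "x \<bullet> - \<phi> u = M_support (- \<phi> u)"
    "y \<in> M_set" "y \<bullet> \<phi> u = M_support (\<phi> u)"
    using M_support_attained e by metis
  have ip: "adjoint \<phi> z \<bullet> u = z \<bullet> \<phi> u" for z by (simp add: adjoint_clauses[OF linear_ident])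
  have "x \<bullet> \<phi> u \<le> z \<bullet> \<phi> u \<and> z \<bullet> \<phi> u \<le> y \<bullet> \<phi> u" if "z \<in> M_set" for z
    using M_support_ge[OF e(1) that] M_support_ge[OF e(2) that] xy by simp
  moreover have "y \<bullet> \<phi> u - x \<bullet> \<phi> u = 2"
    using M_support_antipodal[OF e(1)] xy by simp
  ultimately show "\<exists>x\<in>\<phi> -` U_set. \<exists>y\<in>\<phi> -` U_set.
      (\<forall>z\<in>\<phi> -` U_set. x \<bullet> u \<le> z \<bullet> u \<and> z \<bullet> u \<le> y \<bullet> u) \<and> y \<bullet> u - x \<bullet> u = 2"
    unfolding vimage_U_set using xy(1,3) by (intro bexI[of _ "adjoint \<phi> x"] bexI[of _ "adjoint \<phi> y"]) (auto simp: ip)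
qed

section \<open>The regular simplex and its symmetries\<close>

definition simplex_vertex :: "'m \<Rightarrow> real ^ 'n" where
  "simplex_vertex i = adjoint \<phi> (axis i 1)"

text \<open>Through this expansion, permuting simplex vertices amounts to permuting coordinates
  before the projection.\<close>

lemma adjoint_eq_sum: "adjoint \<phi> x = (\<Sum>i\<in>UNIV. x $ i *\<^sub>R simplex_vertex i)"
proof -
  have "adjoint \<phi> x = adjoint \<phi> (\<Sum>i\<in>UNIV. x $ i *\<^sub>R axis i 1)"
    using basis_expansion[of x] by (simp add: scalar_mult_eq_scaleR)
  then show ?thesis
    by (simp add: linear_sum[OF linear_adj] linear_cmul[OF linear_adj] simplex_vertex_def)
qed

lemma sum_simplex_vertex: "(\<Sum>i\<in>UNIV. simplex_vertex i) = 0"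
  using adjoint_eq_sum[of 1] by (simp add: adjoint_1)

text \<open>The difference of two standard basis vectors already lies in the hyperplane, so the
  projection keeps its length.\<close>

lemma dist_simplex_vertex:
  assumes "i \<noteq> j"
  shows "dist (simplex_vertex i) (simplex_vertex j) = sqrt 2"
proof -
  let ?x = "axis i 1 - axis j 1 :: real ^ 'm"
  have "?x \<in> diag_hyperplane"
    by (simp add: mem_diag_hyperplane sum_subtractf axis_def)
  then have "norm (adjoint \<phi> ?x) = norm ?x" by (metis ident_adjoint norm_ident)
  also have "\<dots> = sqrt 2"
    using assms by (simp add: norm_eq_sqrt_inner inner_diff inner_axis_axis)
  finally show ?thesis by (simp add: dist_norm simplex_vertex_def linear_diff[OF linear_adj])
qed

lemma inj_simplex_vertex: "inj simplex_vertex"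
proof (rule injI, rule ccontr)
  fix i j assume "simplex_vertex i = simplex_vertex j" "i \<noteq> j"
  then show False using dist_simplex_vertex[of i j] by simp
qed

text \<open>The coefficients of an affine dependence sum to 0, so they form a vector of the
  hyperplane, where \<open>adjoint \<phi>\<close> is injective.\<close>

lemma affine_independent_simplex_vertex: "\<not> affine_dependent (range simplex_vertex)"
proof
  assume "affine_dependent (range simplex_vertex)"
  then obtain c i where c: "sum c (range simplex_vertex) = 0" "c (simplex_vertex i) \<noteq> 0"
    "(\<Sum>v\<in>range simplex_vertex. c v *\<^sub>R v) = 0"
    by (auto simp: affine_dependent_explicit_finite)
  define x :: "real ^ 'm" where "x = (\<chi> i. c (simplex_vertex i))"
  have "x \<in> diag_hyperplane"
    using c(1) by (simp add: x_def mem_diag_hyperplane sum.reindex[OF inj_simplex_vertex])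
  moreover have "adjoint \<phi> x = 0"
    using c(3) by (simp add: x_def adjoint_eq_sum sum.reindex[OF inj_simplex_vertex])
  ultimately have "x = 0" by (metis ident_adjoint linear_0 linear_ident)
  then show False using c(2) by (simp add: x_def vec_eq_iff)
qed

lemma extreme_point_simplex:
  "v extreme_point_of (convex hull (range simplex_vertex)) \<longleftrightarrow> v \<in> range simplex_vertex"
  by (rule extreme_point_of_convex_hull_affine_independent[OF affine_independent_simplex_vertex])

lemma regular_simplex_hull:
  assumes "CARD('m) = CARD('n) + 1"
  shows "regular_simplex (convex hull (range simplex_vertex))"
  unfolding regular_simplex_def extreme_point_simplex
proof (intro conjI exI allI impI)
  show "polytope (convex hull (range simplex_vertex))" by (simp add: polytope_convex_hull)
  show "card {v. v \<in> range simplex_vertex} = DIM(real ^ 'n) + 1"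
    using assms by (simp add: card_image[OF inj_simplex_vertex])
  fix u v assume "u \<in> range simplex_vertex \<and> v \<in> range simplex_vertex \<and> u \<noteq> v"
  then obtain i j where "u = simplex_vertex i" "v = simplex_vertex j" "i \<noteq> j" by blast
  then show "dist u v = sqrt 2" using dist_simplex_vertex[of i j] by simp
qed

text \<open>A symmetry maps extreme points to extreme points, hence permutes the vertices by some
  \<open>\<sigma>\<close>. By linearity it acts on projected points as a coordinate permutation,
  under which \<open>M_set\<close> is invariant.\<close>

lemma simplex_symmetry_image_subset:
  assumes \<tau>: "orthogonal_transformation \<tau>"
    and D: "\<tau> ` (convex hull (range simplex_vertex)) = convex hull (range simplex_vertex)"
  shows "\<tau> ` (\<phi> -` U_set) \<subseteq> \<phi> -` U_set"
proof -
  have lin: "linear \<tau>" and inj: "inj \<tau>"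
    using \<tau> orthogonal_transformation_linear orthogonal_transformation_inj by auto
  have "\<tau> (simplex_vertex i) extreme_point_of (\<tau> ` (convex hull (range simplex_vertex)))" for i
    by (intro extreme_point_of_injective_linear_image lin inj) (simp add: extreme_point_simplex)
  then have "\<tau> (simplex_vertex i) \<in> range simplex_vertex" for i
    unfolding D extreme_point_simplex .
  then obtain \<sigma> where \<sigma>: "\<tau> (simplex_vertex i) = simplex_vertex (\<sigma> i)" for i
    unfolding image_iff by (metis UNIV_I)
  have "inj \<sigma>"
    using \<sigma> inj inj_simplex_vertex by (metis injD injI)
  then have bij: "bij \<sigma>" by (simp add: bij_def finite_UNIV_inj_surj)
  have "\<tau> (adjoint \<phi> x) = adjoint \<phi> (\<chi> i. x $ inv \<sigma> i)" for x
  proof -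
    have "\<tau> (adjoint \<phi> x) = (\<Sum>i\<in>UNIV. x $ i *\<^sub>R simplex_vertex (\<sigma> i))"
      by (simp add: adjoint_eq_sum linear_sum[OF lin] linear_cmul[OF lin] \<sigma>)
    \<comment> \<open>Prepares the reindexing by \<open>\<sigma>\<close>: moving vertex
      \<open>i\<close> to vertex \<open>\<sigma> i\<close> permutes the coordinates by the
      inverse.\<close>
    also have "\<dots> = (\<Sum>i\<in>UNIV. x $ inv \<sigma> (\<sigma> i) *\<^sub>R simplex_vertex (\<sigma> i))"
      using \<open>inj \<sigma>\<close> by simp
    also have "\<dots> = (\<Sum>i\<in>UNIV. x $ inv \<sigma> i *\<^sub>R simplex_vertex i)"
      using sum.reindex_bij_betw[OF bij, of "\<lambda>i. x $ inv \<sigma> i *\<^sub>R simplex_vertex i"] by simp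
    finally show ?thesis by (simp add: adjoint_eq_sum)
  qed
  then show ?thesis
    unfolding vimage_U_set using M_set_permute[OF bij_imp_bij_inv[OF bij]] by auto
qed

lemma has_regular_simplex_symmetries_U:
  assumes "CARD('m) = CARD('n) + 1"
  shows "has_regular_simplex_symmetries (\<phi> -` U_set)"
  unfolding has_regular_simplex_symmetries_def
proof (intro exI conjI allI impI)
  let ?D = "convex hull (range simplex_vertex)"
  show "regular_simplex ?D" by (rule regular_simplex_hull[OF assms])
  show "(\<Sum>v | v extreme_point_of ?D. v) = 0"
    by (simp add: extreme_point_simplex sum.reindex[OF inj_simplex_vertex] sum_simplex_vertex)
  fix \<tau> assume \<tau>: "orthogonal_transformation \<tau> \<and> \<tau> ` ?D = ?D"
  then have inv: "orthogonal_transformation (inv \<tau>)" and bij: "bij \<tau>"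
    by (auto simp: orthogonal_transformation_inv orthogonal_transformation_bij)
  have "inv \<tau> ` ?D = ?D"
    using \<tau> bij by (metis bij_is_inj image_inv_f_f)
  \<comment> \<open>The inverse symmetry supplies the opposite inclusion.\<close>
  then have "inv \<tau> ` (\<phi> -` U_set) \<subseteq> \<phi> -` U_set"
    using inv simplex_symmetry_image_subset by blast
  then have "\<phi> -` U_set \<subseteq> \<tau> ` (\<phi> -` U_set)"
    using bij by (metis bij_is_surj image_f_inv_f image_mono)
  then show "\<tau> ` (\<phi> -` U_set) = \<phi> -` U_set"
    using \<tau> simplex_symmetry_image_subset by blast
qed

end

theorem theorem1p1:
  fixes \<phi> :: "real ^ 'n \<Rightarrow> real ^ 'm"
  assumes "CARD('n) \<ge> 2"
    and "CARD('m) = CARD('n) + 1"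
    and "hyperplane_identification \<phi>"
  shows "convex_body (\<phi> -` U_set) \<and> constant_width 2 (\<phi> -` U_set) \<and>
         has_regular_simplex_symmetries (\<phi> -` U_set)"
  using convex_body_U constant_width_U has_regular_simplex_symmetries_U assms by blast

end
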